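(* Let $\mathbf{z}$ be an infinite word over a finite alphabet such that for some integer $k\ge 2$ we have $b^{(k)}_{\mathbf{z}}(n)=n+1$ for all $n\ge 0$. Then $\mathbf{z}$ is Sturmian.
   Context: For words $u,w$, $\binom{u}{w}$ denotes the number of occurrences of $w$ as a scattered subword of $u$. Two words $u,v$ are $k$-binomially equivalent ($u\sim_k v$) if $\binom{u}{x}=\binom{v}{x}$ for all words $x$ of length at most $k$. For an infinite word $\mathbf{x}$, $b^{(k)}_{\mathbf{x}}(n)$ is the number of $\sim_k$-equivalence classes among the length-$n$ factors of $\mathbf{x}$. An infinite word is Sturmian if it has exactly $n+1$ distinct factors of length $n$ for every $n\ge0$. *)

theory Defs
  imports Main
begin

text \<open>Finite words are lists; an infinite word is a function on \<^typ>\<open>nat\<close>.\<close>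

text \<open>An occurrence of \<open>w\<close> as a scattered subword of \<open>u\<close> is a set of positions of \<open>u\<close> at which
  \<open>w\<close> is read in increasing order.\<close>

definition subword_count :: "'a list \<Rightarrow> 'a list \<Rightarrow> nat" where
  "subword_count u w = card {I. I \<subseteq> {..<length u} \<and> nths u I = w}"

definition binomial_equiv :: "nat \<Rightarrow> ('a list \<times> 'a list) set" where
  "binomial_equiv k =
     {(u, v). \<forall>x. length x \<le> k \<longrightarrow> subword_count u x = subword_count v x}"

definition factors :: "(nat \<Rightarrow> 'a) \<Rightarrow> nat \<Rightarrow> 'a list set" where
  "factors z n = {map z [i..<i + n] | i. True}"

definition binomial_complexity :: "nat \<Rightarrow> (nat \<Rightarrow> 'a) \<Rightarrow> nat \<Rightarrow> nat" where
  "binomial_complexity k z n = card (factors z n // binomial_equiv k)"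

definition sturmian :: "(nat \<Rightarrow> 'a) \<Rightarrow> bool" where
  "sturmian z \<longleftrightarrow> (\<forall>n. card (factors z n) = n + 1)"

end

theory Submission
  imports Defs
begin

text \<open>
  Write \<open>D s\<close> for the difference between the numbers of letters \<open>a\<close> in the prefixes of length \<open>s\<close>
  of two factors of length \<open>n\<close> of a binary word. If the word is balanced in all lengths below \<open>n\<close>
  and \<open>a\<close> is the letter at the first mismatch, then \<open>D\<close> is nonnegative and somewhere positive,
  while 2-binomial equivalence forces \<open>\<Sum>s\<le>n. D s = 0\<close>. Hence \<open>k\<close>-binomial equivalence is
  equality on the factors of length \<open>n\<close>.

  It remains to see that the word is balanced in all lengths. Otherwise let \<open>m\<close> be the least
  length in which it is not: there are factors \<open>awa\<close> and \<open>bwb\<close> of length \<open>m\<close> with \<open>w\<close> a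
  palindrome, and by the first part there are exactly \<open>l + 1\<close> factors of every length
  \<open>l \<le> m\<close>. So there is a unique right special factor of length \<open>m - 1\<close>, namely \<open>aw\<close> or \<open>bw\<close>,
  say \<open>aw\<close>. As \<open>w\<close> is a palindrome, \<open>aw\<close> does not occur near the occurrence of \<open>bwb\<close>, and the
  pigeonhole principle makes the word eventually periodic. Then its numbers of factors are bounded,
  which contradicts the hypothesis.
\<close>

subsection \<open>Subword counts\<close>

lemma subword_count_Nil_right: "subword_count u [] = 1"
proof -
  have "{I. I \<subseteq> {..<length u} \<and> nths u I = []} = {{}}"
  proof (intro equalityI subsetI)
    fix I assume "I \<in> {I. I \<subseteq> {..<length u} \<and> nths u I = []}"
    then have I: "I \<subseteq> {..<length u}" and e: "set (nths u I) = {}" by auto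
    from e have "\<not> (\<exists>i<length u. i \<in> I)" unfolding set_nths by blast
    with I show "I \<in> {{}}" by auto
  qed auto
  then show ?thesis unfolding subword_count_def by simp
qed

lemma subword_count_Nil_Cons: "subword_count [] (c # w) = 0"
  by (simp add: subword_count_def)

text \<open>A Pascal-type recursion: occurrences are split by whether they use position 0, and the
  remaining positions are shifted down by one.\<close>

lemma subword_count_Cons_Cons:
  "subword_count (x # u) (c # w) =
     subword_count u (c # w) + (if x = c then subword_count u w else 0)"
proof -
  define S where "S w = {I. I \<subseteq> {..<length u} \<and> nths u I = w}" for w
  define T where "T = {I. I \<subseteq> {..<length (x # u)} \<and> nths (x # u) I = c # w}"
  define A where "A = (\<lambda>I. Suc ` I) ` S (c # w)"
  define B where "B = (if x = c then (\<lambda>I. insert 0 (Suc ` I)) ` S w else {})"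
  have fin: "finite (S v)" for v
    by (rule finite_subset[of _ "Pow {..<length u}"]) (auto simp: S_def)
  have pre: "{j. Suc j \<in> Suc ` I} = I" "{j. Suc j \<in> insert 0 (Suc ` I)} = I" for I
    by auto
  have split: "I = (if 0 \<in> I then insert 0 (Suc ` {j. Suc j \<in> I}) else Suc ` {j. Suc j \<in> I})"
    for I :: "nat set"
  proof -
    have "n \<in> I \<longleftrightarrow> n \<in> (if 0 \<in> I then insert 0 (Suc ` {j. Suc j \<in> I}) else Suc ` {j. Suc j \<in> I})" for n
      by (cases n) auto
    then show ?thesis by blast
  qed
  have "T = A \<union> B"
  proof (intro equalityI subsetI)
    fix I assume I: "I \<in> T"
    let ?J = "{j. Suc j \<in> I}"
    have J: "?J \<subseteq> {..<length u}" using I by (auto simp: T_def)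
    have e: "nths (x # u) I = c # w" using I by (simp add: T_def)
    show "I \<in> A \<union> B"
    proof (cases "0 \<in> I")
      case True
      with e J have "x = c" "?J \<in> S w" by (auto simp: S_def nths_Cons)
      moreover have "I = insert 0 (Suc ` ?J)" using split[of I] True by simp
      ultimately show ?thesis unfolding B_def by auto
    next
      case False
      with e J have "?J \<in> S (c # w)" by (auto simp: S_def nths_Cons)
      moreover have "I = Suc ` ?J" using split[of I] False by simp
      ultimately show ?thesis unfolding A_def by blast
    qed
  next
    fix I assume "I \<in> A \<union> B"
    then show "I \<in> T"
      by (auto simp: A_def B_def S_def T_def nths_Cons pre split: if_splits)
  qed
  moreover have "A \<inter> B = {}" by (auto simp: A_def B_def)
  moreover have "finite A" "finite B" using fin by (auto simp: A_def B_def)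
  ultimately have "card T = card A + card B" by (simp add: card_Un_disjoint)
  moreover have "inj_on (\<lambda>I. Suc ` I) X" for X
    by (rule inj_onI) (metis pre(1))
  then have "card A = card (S (c # w))" unfolding A_def by (rule card_image)
  moreover have "inj_on (\<lambda>I. insert 0 (Suc ` I)) X" for X
    by (rule inj_onI) (metis pre(2))
  then have "card B = (if x = c then card (S w) else 0)"
    unfolding B_def by (simp add: card_image)
  ultimately show ?thesis unfolding subword_count_def S_def T_def by simp
qed

lemmas subword_count_rec =
  subword_count_Nil_right subword_count_Nil_Cons subword_count_Cons_Cons

subsection \<open>Factors\<close>

abbreviation factor_at :: "(nat \<Rightarrow> 'a) \<Rightarrow> nat \<Rightarrow> nat \<Rightarrow> 'a list" where
  "factor_at z i n \<equiv> map z [i..<i + n]"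

lemma factor_at_in_factors: "factor_at z i n \<in> factors z n"
  by (auto simp: factors_def)

lemma factor_at_eq_iff: "factor_at z i n = factor_at z j n \<longleftrightarrow> (\<forall>s<n. z (i + s) = z (j + s))"
  by (auto simp: list_eq_iff_nth_eq)

lemma factor_at_Suc: "factor_at z i (Suc n) = z i # factor_at z (Suc i) n"
  by (simp add: upt_conv_Cons del: upt_Suc)

lemma butlast_factor_at: "butlast (factor_at z i (Suc n)) = factor_at z i n"
  by (simp add: butlast_append)

lemma finite_factors: "finite (factors (z :: nat \<Rightarrow> 'a::finite) n)"
proof (rule finite_subset)
  show "factors z n \<subseteq> {xs. set xs \<subseteq> UNIV \<and> length xs = n}"
    by (auto simp: factors_def)
  show "finite {xs :: 'a list. set xs \<subseteq> UNIV \<and> length xs = n}"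
    by (rule finite_lists_length_eq) simp
qed

lemma butlast_image_factors: "butlast ` factors z (Suc n) = factors z n"
proof (intro equalityI subsetI)
  fix x assume "x \<in> butlast ` factors z (Suc n)"
  then obtain i where "x = butlast (factor_at z i (Suc n))" by (auto simp: factors_def)
  then have "x = factor_at z i n" by (simp only: butlast_factor_at)
  then show "x \<in> factors z n" by (simp add: factor_at_in_factors)
next
  fix x assume "x \<in> factors z n"
  then obtain i where "x = factor_at z i n" by (auto simp: factors_def)
  then have "x = butlast (factor_at z i (Suc n))" by (simp only: butlast_factor_at)
  then show "x \<in> butlast ` factors z (Suc n)" using factor_at_in_factors[of z i "Suc n"] by blast
qed

text \<open>A start \<open>r \<ge> p + d\<close> can be moved back by \<open>d\<close> without
  changing the factor, so the starts below \<open>p + d\<close> yield every factor.\<close>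

lemma card_factors_eventually_periodic:
  assumes d: "d > 0" and per: "\<And>r. r \<ge> p \<Longrightarrow> z (r + d) = z r"
  shows "card (factors z n) \<le> p + d"
proof -
  have "\<exists>r'<p + d. factor_at z r n = factor_at z r' n" for r
  proof (induction r rule: less_induct)
    case (less r)
    show ?case
    proof (cases "r < p + d")
      case False
      then have "z (r + s) = z (r - d + s)" for s using per[of "r - d + s"] by simp
      then have "factor_at z r n = factor_at z (r - d) n" unfolding factor_at_eq_iff by blast
      moreover have "r - d < r" using d False by simp
      ultimately show ?thesis using less by metis
    qed blast
  qed
  then have "factors z n \<subseteq> (\<lambda>r. factor_at z r n) ` {..<p + d}"
    unfolding factors_def by fastforce
  then have "card (factors z n) \<le> card ((\<lambda>r. factor_at z r n) ` {..<p + d})"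
    by (rule card_mono[rotated]) simp
  also have "\<dots> \<le> p + d" using card_image_le[of "{..<p + d}"] by simp
  finally show ?thesis .
qed

section \<open>Right special factors and eventual periodicity\<close>

text \<open>\<open>butlast\<close> maps the factors of length \<open>n + 1\<close> onto the fewer
  factors of length \<open>n\<close>, so it identifies two of them.\<close>

lemma right_special_exists:
  fixes z :: "nat \<Rightarrow> 'a::finite"
  assumes "card (factors z n) < card (factors z (Suc n))"
  obtains r s where "factor_at z r n = factor_at z s n" "z (r + n) \<noteq> z (s + n)"
proof -
  have "\<not> inj_on butlast (factors z (Suc n))"
    using assms card_image[of butlast "factors z (Suc n)"] butlast_image_factors[of z n] by auto
  then obtain r s where
    e: "butlast (factor_at z r (Suc n)) = butlast (factor_at z s (Suc n))" and
    ne: "factor_at z r (Suc n) \<noteq> factor_at z s (Suc n)"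
    unfolding inj_on_def factors_def by blast
  from e have e': "factor_at z r n = factor_at z s n" unfolding butlast_factor_at .
  with ne have "z (r + n) \<noteq> z (s + n)" unfolding factor_at_eq_iff by (metis less_Suc_eq)
  with e' show ?thesis by (rule that)
qed

text \<open>With two different right special factors, one extension of each (\<open>x\<close> and
  \<open>x'\<close>) could be dropped and \<open>butlast\<close> would remain onto, because
  \<open>y\<close> and \<open>y'\<close> survive. The count would then grow by at least 2.\<close>

lemma right_special_unique:
  fixes z :: "nat \<Rightarrow> 'a::finite"
  assumes card: "card (factors z (Suc n)) \<le> card (factors z n) + 1"
    and r: "factor_at z r n = factor_at z s n" "z (r + n) \<noteq> z (s + n)"
    and r': "factor_at z r' n = factor_at z s' n" "z (r' + n) \<noteq> z (s' + n)"
  shows "factor_at z r n = factor_at z r' n"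
proof (rule ccontr)
  assume ne: "factor_at z r n \<noteq> factor_at z r' n"
  define x x' where "x = factor_at z r (Suc n)" and "x' = factor_at z r' (Suc n)"
  define y y' where "y = factor_at z s (Suc n)" and "y' = factor_at z s' (Suc n)"
  have bl: "butlast x = factor_at z r n" "butlast x' = factor_at z r' n"
    "butlast y = factor_at z s n" "butlast y' = factor_at z s' n"
    unfolding x_def x'_def y_def y'_def by (simp_all only: butlast_factor_at)
  have mem: "x \<in> factors z (Suc n)" "x' \<in> factors z (Suc n)" "y \<in> factors z (Suc n)"
    "y' \<in> factors z (Suc n)"
    unfolding x_def x'_def y_def y'_def by (simp_all only: factor_at_in_factors)
  have "y \<noteq> x" "y' \<noteq> x'" unfolding x_def x'_def y_def y'_def factor_at_eq_iff
    using r(2) r'(2) by (metis lessI)+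
  moreover have "x \<noteq> x'" "y \<noteq> x'" "y' \<noteq> x" using bl ne r r' by metis+
  ultimately have dist: "y \<notin> {x, x'}" "y' \<notin> {x, x'}" "x \<noteq> x'" by auto
  have "factors z n \<subseteq> butlast ` (factors z (Suc n) - {x, x'})"
  proof
    fix v assume "v \<in> factors z n"
    then obtain u where u: "u \<in> factors z (Suc n)" "v = butlast u"
      using butlast_image_factors[of z n] by blast
    have "y \<in> factors z (Suc n) - {x, x'}" "y' \<in> factors z (Suc n) - {x, x'}"
      using mem dist by blast+
    moreover have "butlast y = butlast x" "butlast y' = butlast x'" using bl r r' by simp_all
    ultimately show "v \<in> butlast ` (factors z (Suc n) - {x, x'})"
      using u by (cases "u \<in> {x, x'}") (auto intro: rev_image_eqI)
  qed
  then have "card (factors z n) \<le> card (factors z (Suc n) - {x, x'})"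
    by (meson finite_factors finite_Diff surj_card_le)
  also have "\<dots> = card (factors z (Suc n)) - 2"
    using mem dist by (simp add: card_Diff_subset)
  finally have "card (factors z n) \<le> card (factors z (Suc n)) - 2" .
  \<comment> \<open>This excludes truncation in the subtraction of 2.\<close>
  moreover have "card {x, x'} \<le> card (factors z (Suc n))"
    using mem by (intro card_mono finite_factors) auto
  ultimately show False using card dist by simp
qed

text \<open>Here \<open>cw\<close> occurs at \<open>i\<close> and \<open>dwd\<close> at \<open>j\<close>, where \<open>w\<close> is a palindrome of length \<open>n - 1\<close>,
  and no factor of length \<open>n\<close> other than \<open>cw\<close> is right special.\<close>

lemma eventually_periodic_if_right_special:
  fixes z :: "nat \<Rightarrow> 'a::finite"
  assumes n: "n > 0" and card: "card (factors z n) = n + 1"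
    and ij: "z i \<noteq> z j" "z (j + n) = z j"
    and w: "\<And>s. 0 < s \<Longrightarrow> s < n \<Longrightarrow> z (i + s) = z (j + s)"
    and pal: "\<And>s. 0 < s \<Longrightarrow> s < n \<Longrightarrow> z (i + s) = z (i + (n - s))"
    and special: "\<And>r s. factor_at z r n = factor_at z s n \<Longrightarrow> z (r + n) \<noteq> z (s + n)
      \<Longrightarrow> factor_at z r n = factor_at z i n"
  obtains p d where "d > 0" "\<And>r. r \<ge> p \<Longrightarrow> z (r + d) = z r"
proof -
  \<comment> \<open>If \<open>cw\<close> began strictly inside \<open>dwd\<close>, the final
    \<open>d\<close> would be letter \<open>n - t\<close> of \<open>cw\<close>. The palindrome makes
    this letter \<open>t\<close> of \<open>w\<close>, which is the initial \<open>c\<close> of that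
    occurrence.\<close>
  have away: "factor_at z (j + t) n \<noteq> factor_at z i n" if t: "t \<le> n" for t
  proof
    assume "factor_at z (j + t) n = factor_at z i n"
    then have e: "z (j + t + s) = z (i + s)" if "s < n" for s
      using that unfolding factor_at_eq_iff by blast
    from e[of 0] n have e0: "z (j + t) = z i" by simp
    with ij have "t \<noteq> 0" "t \<noteq> n" by (metis add_0_right)+
    with t have t': "0 < t" "t < n" by auto
    then have "z (j + n) = z (i + (n - t))" using e[of "n - t"] by simp
    also have "\<dots> = z (j + t)" using pal w t' by simp
    finally show False using e0 ij by simp
  qed
  \<comment> \<open>There are \<open>n + 1\<close> starts, but only \<open>n\<close> factors other
    than \<open>cw\<close>.\<close>
  have "\<not> inj_on (\<lambda>t. factor_at z (j + t) n) {..n}"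
  proof
    assume "inj_on (\<lambda>t. factor_at z (j + t) n) {..n}"
    moreover have "(\<lambda>t. factor_at z (j + t) n) ` {..n} \<subseteq> factors z n - {factor_at z i n}"
    proof (rule image_subsetI)
      fix t assume "t \<in> {..n}"
      then have "factor_at z (j + t) n \<noteq> factor_at z i n" by (intro away) simp
      then show "factor_at z (j + t) n \<in> factors z n - {factor_at z i n}"
        using factor_at_in_factors by (intro DiffI) simp_all
    qed
    ultimately have "card {..n} \<le> card (factors z n - {factor_at z i n})"
      by (rule card_inj_on_le) (simp add: finite_factors)
    also have "\<dots> = n" using card factor_at_in_factors[of z i n] finite_factors[of z n] by simp
    finally show False by simp
  qed
  then obtain t t' where t: "t < t'" "t' \<le> n" "factor_at z (j + t) n = factor_at z (j + t') n"
    unfolding inj_on_def by (metis atMost_iff linorder_neqE_nat)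
  define p d where "p = j + t" and "d = t' - t"
  have d: "d > 0" "p + d \<le> j + n" "factor_at z p n = factor_at z (p + d) n"
    using t by (simp_all add: p_def d_def)
  \<comment> \<open>Both claims need a joint induction: a factor other than \<open>cw\<close>
    determines its next letter, which propagates the coincidence, and the coincidence carries the
    avoidance of \<open>cw\<close> beyond \<open>j + n\<close>.\<close>
  have main: "factor_at z (p + t) n = factor_at z (p + d + t) n \<and>
      factor_at z (p + t) n \<noteq> factor_at z i n" for t
  proof (induction t rule: less_induct)
    case (less t)
    have "factor_at z (p + t) n = factor_at z (p + d + t) n"
    proof (cases t)
      case 0
      with d show ?thesis by simp
    next
      case (Suc t')
      with less have IH: "factor_at z (p + t') n = factor_at z (p + d + t') n"
        "factor_at z (p + t') n \<noteq> factor_at z i n" by blast+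
      then have nxt: "z (p + t' + n) = z (p + d + t' + n)" using special by blast
      have "z (p + t + s) = z (p + d + t + s)" if "s < n" for s
      proof (cases "Suc s = n")
        case True
        with nxt Suc show ?thesis by (auto simp: ac_simps)
      next
        case False
        with that have "Suc s < n" by simp
        with IH(1) have "z (p + t' + Suc s) = z (p + d + t' + Suc s)"
          unfolding factor_at_eq_iff by blast
        with Suc show ?thesis by simp
      qed
      then show ?thesis unfolding factor_at_eq_iff by blast
    qed
    moreover have "factor_at z (p + t) n \<noteq> factor_at z i n"
    proof (cases "p + t \<le> j + n")
      case True
      then show ?thesis using away[of "p + t - j"] by (simp add: p_def add.assoc)
    next
      case False
      \<comment> \<open>Here \<open>p + d \<le> j + n < p + t\<close>, so \<open>t - d\<close> is
        not truncated.\<close>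
      then have "t - d < t" "p + d + (t - d) = p + t" using d by auto
      then show ?thesis using less[of "t - d"] by metis
    qed
    ultimately show ?case by blast
  qed
  show ?thesis
  proof (rule that[OF d(1), of p])
    fix r assume "p \<le> r"
    then have "factor_at z r n = factor_at z (r + d) n" using main[of "r - p"] by (simp add: ac_simps)
    then show "z (r + d) = z r" using n unfolding factor_at_eq_iff by force
  qed
qed

subsection \<open>Balanced words\<close>

text \<open>Integer values allow differences without truncation.\<close>

definition prefix_count :: "(nat \<Rightarrow> 'a) \<Rightarrow> 'a \<Rightarrow> nat \<Rightarrow> int" where
  "prefix_count z a i = (\<Sum>j<i. if z j = a then 1 else 0)"

text \<open>The one-sided bound gives the absolute one by exchanging \<open>i\<close> and
  \<open>j\<close>.\<close>

definition balanced_at :: "(nat \<Rightarrow> 'a) \<Rightarrow> 'a \<Rightarrow> nat \<Rightarrow> bool" where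
  "balanced_at z a n \<longleftrightarrow> (\<forall>i j. (prefix_count z a (i + n) - prefix_count z a i)
     - (prefix_count z a (j + n) - prefix_count z a j) \<le> 1)"

lemma prefix_count_Suc:
  "prefix_count z a (Suc i) = prefix_count z a i + (if z i = a then 1 else 0)"
  by (simp add: prefix_count_def)

lemma subword_count_single:
  "int (subword_count (factor_at z i n) [a]) = prefix_count z a (i + n) - prefix_count z a i"
proof (induction n arbitrary: i)
  case (Suc n)
  then show ?case unfolding factor_at_Suc
    using Suc[of "Suc i"] by (simp add: subword_count_rec prefix_count_Suc)
qed (simp add: subword_count_rec)

lemma prefix_count_add:
  assumes "a \<noteq> b" "range z \<subseteq> {a, b}"
  shows "prefix_count z a i + prefix_count z b i = int i"
proof (induction i)
  case (Suc i)
  have "z i = a \<or> z i = b" using assms(2) by blast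
  with Suc assms(1) show ?case by (auto simp: prefix_count_Suc)
qed (simp add: prefix_count_def)

text \<open>Each \<open>a\<close> is counted once for itself and once for every later letter. With
  \<open>c\<close> letters \<open>a\<close>, the later letters \<open>b\<close> give the occurrences
  of \<open>ab\<close>, and the rest gives \<open>c * (c + 1) / 2\<close>; doubling avoids the
  division.\<close>

lemma sum_prefix_count:
  assumes "a \<noteq> b" "range z \<subseteq> {a, b}"
  shows "2 * (\<Sum>s\<le>n. prefix_count z a (i + s) - prefix_count z a i) =
    2 * int (subword_count (factor_at z i n) [a, b]) +
    (prefix_count z a (i + n) - prefix_count z a i) *
      (prefix_count z a (i + n) - prefix_count z a i + 1)"
proof (induction n arbitrary: i)
  case (Suc n)
  let ?e = "if z i = a then 1 else 0 :: int"
  let ?P = "prefix_count z a"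
  let ?c = "?P (Suc i + n) - ?P (Suc i)"
  have "(\<Sum>s\<le>Suc n. ?P (i + s) - ?P i) = (\<Sum>s\<le>n. ?P (i + Suc s) - ?P i)"
    by (simp add: sum.atMost_Suc_shift del: sum.atMost_Suc)
  also have "\<dots> = (\<Sum>s\<le>n. (?P (Suc i + s) - ?P (Suc i)) + ?e)"
    by (intro sum.cong) (auto simp: prefix_count_Suc)
  also have "\<dots> = (\<Sum>s\<le>n. ?P (Suc i + s) - ?P (Suc i)) + (int n + 1) * ?e"
    unfolding sum.distrib by simp
  finally have 1: "2 * (\<Sum>s\<le>Suc n. ?P (i + s) - ?P i) =
      2 * int (subword_count (factor_at z (Suc i) n) [a, b]) + ?c * (?c + 1) + 2 * ((int n + 1) * ?e)"
    using Suc[of "Suc i"] by (simp only: distrib_left)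
  have "int (subword_count (factor_at z (Suc i) n) [b]) = int n - ?c"
    using prefix_count_add[OF assms, of "Suc i"] prefix_count_add[OF assms, of "Suc i + n"]
    unfolding subword_count_single by simp
  then have 2: "int (subword_count (factor_at z i (Suc n)) [a, b]) =
      int (subword_count (factor_at z (Suc i) n) [a, b]) + ?e * (int n - ?c)"
    unfolding factor_at_Suc by (simp add: subword_count_Cons_Cons)
  have 3: "?P (i + Suc n) - ?P i = ?c + ?e" by (simp add: prefix_count_Suc)
  have "?e = 0 \<or> ?e = 1" by simp
  then show ?case unfolding 1 2 3 by (elim disjE) (simp_all only:, simp_all add: algebra_simps)
qed (simp add: subword_count_rec)

text \<open>The counts of \<open>[a]\<close> and \<open>[a, b]\<close> fix the sum of the prefix
  counts, whereas a first mismatch with \<open>a\<close> on the side of \<open>i\<close> only would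
  make this sum strictly larger there.\<close>

lemma binomial_equiv_imp_same_letter:
  assumes ab: "a \<noteq> b" "range z \<subseteq> {a, b}"
    and bal: "\<And>l. l < n \<Longrightarrow> balanced_at z a l"
    and eq: "(factor_at z i n, factor_at z j n) \<in> binomial_equiv k" and k: "k \<ge> 2"
    and t: "t < n" "\<And>s. s < t \<Longrightarrow> z (i + s) = z (j + s)" and a: "z (i + t) = a"
  shows "z (j + t) = a"
proof (rule ccontr)
  assume na: "z (j + t) \<noteq> a"
  let ?P = "prefix_count z a"
  define D where "D s = (?P (i + s) - ?P i) - (?P (j + s) - ?P j)" for s
  have "subword_count (factor_at z i n) [a] = subword_count (factor_at z j n) [a]"
    using eq k unfolding binomial_equiv_def by auto
  then have same: "?P (i + n) - ?P i = ?P (j + n) - ?P j"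
    unfolding subword_count_single[symmetric] by simp
  have "subword_count (factor_at z i n) [a, b] = subword_count (factor_at z j n) [a, b]"
    using eq k unfolding binomial_equiv_def by auto
  then have "(\<Sum>s\<le>n. ?P (i + s) - ?P i) = (\<Sum>s\<le>n. ?P (j + s) - ?P j)"
    using sum_prefix_count[OF ab, of i n] sum_prefix_count[OF ab, of j n] same by simp
  then have sum0: "(\<Sum>s\<le>n. D s) = 0" unfolding D_def sum_subtractf by simp
  have D0: "D s = 0" if "s \<le> t" for s using that
  proof (induction s)
    case (Suc s)
    then show ?case using t(2)[of s] by (simp add: D_def prefix_count_Suc)
  qed (simp add: D_def)
  have D1: "D (Suc t) = 1" using D0[of t] a na by (simp add: D_def prefix_count_Suc)
  \<comment> \<open>After the mismatch \<open>D\<close> is 1, and balance in length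
    \<open>s - Suc t < n\<close> lets it drop by at most 1.\<close>
  have "D s \<ge> 0" if s: "s \<le> n" for s
  proof (cases "s \<le> t")
    case False
    then have "balanced_at z a (s - Suc t)" using s by (intro bal) simp
    then have "(?P (j + Suc t + (s - Suc t)) - ?P (j + Suc t))
      - (?P (i + Suc t + (s - Suc t)) - ?P (i + Suc t)) \<le> 1"
      unfolding balanced_at_def by blast
    moreover have "j + Suc t + (s - Suc t) = j + s" "i + Suc t + (s - Suc t) = i + s"
      using False by auto
    ultimately have "(?P (j + s) - ?P (j + Suc t)) - (?P (i + s) - ?P (i + Suc t)) \<le> 1"
      by (simp only:)
    then show ?thesis using D1 unfolding D_def by linarith
  qed (simp add: D0)
  then have "D (Suc t) = 0"
    using sum0 t(1) sum_nonneg_eq_0_iff[of "{..n}" D] by auto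
  with D1 show False by simp
qed

lemma binomial_equiv_imp_eq:
  assumes ab: "a \<noteq> b" "range z \<subseteq> {a, b}"
    and bal: "\<And>l. l < n \<Longrightarrow> balanced_at z a l"
    and eq: "(factor_at z i n, factor_at z j n) \<in> binomial_equiv k" and k: "k \<ge> 2"
  shows "factor_at z i n = factor_at z j n"
proof -
  have sym: "(factor_at z j n, factor_at z i n) \<in> binomial_equiv k"
    using eq by (simp add: binomial_equiv_def)
  have "z (i + t) = z (j + t)" if "t < n" for t using that
  proof (induction t rule: less_induct)
    case (less t)
    then have "z (i + s) = z (j + s)" if "s < t" for s using that by simp
    then have "z (i + t) = a \<longleftrightarrow> z (j + t) = a"
      using binomial_equiv_imp_same_letter[OF ab bal eq k less.prems]
        binomial_equiv_imp_same_letter[OF ab bal sym k less.prems] by metis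
    moreover have "z (i + t) \<in> {a, b}" "z (j + t) \<in> {a, b}" using ab(2) by blast+
    ultimately show ?case by auto
  qed
  then show ?thesis unfolding factor_at_eq_iff by blast
qed

text \<open>Shorter blocks differ by at most 1, so a difference of 2 must arise from the first and
  the last letter alone. Comparing prefixes of one word with suffixes of the other makes the common
  middle a palindrome.\<close>

lemma minimal_unbalanced:
  assumes ab: "a \<noteq> b" "range z \<subseteq> {a, b}"
    and bal: "\<And>l. l < m \<Longrightarrow> balanced_at z a l" and unbal: "\<not> balanced_at z a m"
  obtains n i j where "m = Suc n" "n > 0" "z i = a" "z (i + n) = a" "z j = b" "z (j + n) = b"
    "\<And>s. 0 < s \<Longrightarrow> s < n \<Longrightarrow> z (i + s) = z (j + s)"
    "\<And>s. 0 < s \<Longrightarrow> s < n \<Longrightarrow> z (i + s) = z (i + (n - s))"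
proof -
  let ?P = "prefix_count z a"
  obtain i j where ij: "(?P (i + m) - ?P i) - (?P (j + m) - ?P j) \<ge> 2"
    using unbal unfolding balanced_at_def by (metis add1_zle_eq not_le one_add_one)
  define Q where "Q s = ?P (i + s) - ?P i" for s
  define R where "R s = ?P (j + s) - ?P j" for s
  have Q0: "Q 0 = 0" "R 0 = 0" by (simp_all add: Q_def R_def)
  have QSuc: "Q (Suc s) = Q s + (if z (i + s) = a then 1 else 0)"
    "R (Suc s) = R s + (if z (j + s) = a then 1 else 0)" for s
    by (simp_all add: Q_def R_def prefix_count_Suc)
  have Dm: "Q m - R m \<ge> 2" using ij by (simp add: Q_def R_def)
  have "m \<noteq> 0"
  proof
    assume "m = 0"
    with Dm Q0 show False by simp
  qed
  moreover have "m \<noteq> 1"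
  proof
    assume "m = 1"
    with Dm QSuc[of 0] Q0 show False by (simp split: if_splits)
  qed
  ultimately obtain n where n: "m = Suc n" "n > 0" by (cases m) auto
  have cmp: "(Q (p + l) - Q p) - (R (q + l) - R q) \<le> 1"
    "(R (p + l) - R p) - (Q (q + l) - Q q) \<le> 1" if "l \<le> n" for p q l
  proof -
    have "balanced_at z a l" using that n by (intro bal) simp
    then have "(?P (i + p + l) - ?P (i + p)) - (?P (j + q + l) - ?P (j + q)) \<le> 1"
      "(?P (j + p + l) - ?P (j + p)) - (?P (i + q + l) - ?P (i + q)) \<le> 1"
      unfolding balanced_at_def by blast+
    then show "(Q (p + l) - Q p) - (R (q + l) - R q) \<le> 1"
      "(R (p + l) - R p) - (Q (q + l) - Q q) \<le> 1"
      unfolding Q_def R_def by (simp_all add: add.assoc)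
  qed
  \<comment> \<open>A cut at \<open>s\<close> leaves two parts that contribute at most 1 each, while
    the total is at least 2.\<close>
  have D: "Q s - R s = 1" "Q m - R m = 2" if "0 < s" "s \<le> n" for s
  proof -
    have "Q s - R s \<le> 1" using cmp(1)[of s 0 0] that Q0 by simp
    moreover have "(Q m - Q s) - (R m - R s) \<le> 1" using cmp(1)[of "m - s" s s] that n by simp
    ultimately show "Q s - R s = 1" "Q m - R m = 2" using Dm by linarith+
  qed
  have sym: "Q s + Q (m - s) = Q m" if s: "0 < s" "s \<le> n" for s
  proof -
    have e: "m - s + s = m" "0 < m - s" "m - s \<le> n" using s n by auto
    have "Q s - (R m - R (m - s)) \<le> 1" using cmp(1)[of s 0 "m - s"] s e Q0 by simp
    moreover have "(Q m - Q (m - s)) - R s \<le> 1" using cmp(1)[of s "m - s" 0] s e Q0 by simp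
    ultimately show ?thesis using D[OF s] D(1)[OF e(2,3)] by linarith
  qed
  have letter: "z p \<noteq> a \<longleftrightarrow> z p = b" for p using ab by blast
  show ?thesis
  proof (rule that[OF n, of i j])
    have "Q 1 - R 1 = 1" using D n by simp
    then show "z i = a" "z j = b"
      using QSuc[of 0] Q0 letter[of j] by (auto split: if_splits)
    have "Q (Suc n) - Q n - (R (Suc n) - R n) = 1" using D[of n] n by simp
    then show "z (i + n) = a" "z (j + n) = b"
      using QSuc[of n] letter[of "j + n"] by (auto split: if_splits)
  next
    fix s assume s: "0 < s" "s < n"
    have "Q (Suc s) - Q s = R (Suc s) - R s" using D(1)[of s] D(1)[of "Suc s"] s by simp
    then show "z (i + s) = z (j + s)"
      using QSuc[of s] letter[of "i + s"] letter[of "j + s"] by (auto split: if_splits)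
    \<comment> \<open>Subtracting \<open>sym\<close> at \<open>s\<close> and at \<open>Suc s\<close>
      compares letter \<open>s\<close> with its mirror image, letter \<open>n - s\<close>.\<close>
    have "m - s = Suc (n - s)" "m - Suc s = n - s" using s n by auto
    then have "Q (Suc s) - Q s = Q (Suc (n - s)) - Q (n - s)"
      using sym[of s] sym[of "Suc s"] s by simp
    then show "z (i + s) = z (i + (n - s))"
      using QSuc(1)[of s] QSuc(1)[of "n - s"] letter[of "i + s"] letter[of "i + (n - s)"]
      by (auto split: if_splits)
  qed
qed

lemma balanced_if_card_factors:
  fixes z :: "nat \<Rightarrow> 'a::finite"
  assumes ab: "a \<noteq> b" "range z \<subseteq> {a, b}"
    and bal: "\<And>l. l < m \<Longrightarrow> balanced_at z a l"
    and card: "\<And>l. l \<le> m \<Longrightarrow> card (factors z l) = l + 1"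
    and unbounded: "\<And>n. card (factors z n) \<ge> n + 1"
  shows "balanced_at z a m"
proof (rule ccontr)
  assume "\<not> balanced_at z a m"
  from minimal_unbalanced[OF ab bal this] obtain n i j where
    n: "m = Suc n" "n > 0" and i: "z i = a" "z (i + n) = a" and j: "z j = b" "z (j + n) = b"
    and w: "\<And>s. 0 < s \<Longrightarrow> s < n \<Longrightarrow> z (i + s) = z (j + s)"
    and pal: "\<And>s. 0 < s \<Longrightarrow> s < n \<Longrightarrow> z (i + s) = z (i + (n - s))"
    by metis
  have cards: "card (factors z (n - 1)) = n" "card (factors z n) = n + 1"
    "card (factors z (Suc n)) = n + 2"
    using card[of "n - 1"] card[of n] card[of "Suc n"] n by auto
  obtain r s where rs: "factor_at z r n = factor_at z s n" "z (r + n) \<noteq> z (s + n)"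
    using right_special_exists[of z n] cards by auto
  have only: "factor_at z r' n = factor_at z r n"
    if "factor_at z r' n = factor_at z s' n" "z (r' + n) \<noteq> z (s' + n)" for r' s'
    using right_special_unique[OF _ that rs] cards by simp
  \<comment> \<open>Deleting the first letter of a right special factor leaves a right special one.
    So is \<open>w\<close>, which is followed by both \<open>a\<close> and \<open>b\<close>, and
    uniqueness in length \<open>n - 1\<close> applies.\<close>
  have "factor_at z (Suc r) (n - 1) = factor_at z (Suc i) (n - 1)"
  proof (rule right_special_unique)
    show "card (factors z (Suc (n - 1))) \<le> card (factors z (n - 1)) + 1" using cards n by simp
    show "z (Suc r + (n - 1)) \<noteq> z (Suc s + (n - 1))" using rs n by simp
    show "z (Suc i + (n - 1)) \<noteq> z (Suc j + (n - 1))" using i j ab n by simp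
    show "factor_at z (Suc r) (n - 1) = factor_at z (Suc s) (n - 1)"
      using rs(1) unfolding factor_at_eq_iff
      by (metis Suc_pred' add_Suc_shift n(2) not_less_eq)
    show "factor_at z (Suc i) (n - 1) = factor_at z (Suc j) (n - 1)"
      using w unfolding factor_at_eq_iff
      by (metis Suc_pred' add_Suc_shift n(2) not_less_eq zero_less_Suc)
  qed
  then have tl: "z (r + t) = z (i + t)" if "0 < t" "t < n" for t
    using that unfolding factor_at_eq_iff
    by (metis Suc_pred' add_Suc_shift n(2) not_less_eq)
  have "\<exists>p d. d > 0 \<and> (\<forall>r\<ge>p. z (r + d) = z r)"
  proof (cases "z r = a")
    case True
    then have "z (r + t) = z (i + t)" if "t < n" for t using tl[of t] that i by (cases "t = 0") auto
    then have "factor_at z r n = factor_at z i n" unfolding factor_at_eq_iff by blast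
    with only have 1: "factor_at z r' n = factor_at z i n"
      if "factor_at z r' n = factor_at z s' n" "z (r' + n) \<noteq> z (s' + n)" for r' s'
      using that by metis
    have "z i \<noteq> z j" "z (j + n) = z j" using i j ab(1) by simp_all
    then show ?thesis
      by (rule eventually_periodic_if_right_special[OF n(2) cards(2)])
        (fact w, fact pal, erule (1) 1, blast)
  next
    case False
    then have "z r = b" using ab by blast
    then have "z (r + t) = z (j + t)" if "t < n" for t
      using tl[of t] that j w[of t] by (cases "t = 0") auto
    then have "factor_at z r n = factor_at z j n" unfolding factor_at_eq_iff by blast
    with only have 1: "factor_at z r' n = factor_at z j n"
      if "factor_at z r' n = factor_at z s' n" "z (r' + n) \<noteq> z (s' + n)" for r' s'
      using that by metis
    \<comment> \<open>Now \<open>bw\<close> is right special, and \<open>awa\<close> and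
      \<open>bwb\<close> exchange roles.\<close>
    have 2: "z (j + s) = z (i + s)" if "0 < s" "s < n" for s using w that by simp
    have 3: "z (j + s) = z (j + (n - s))" if "0 < s" "s < n" for s
      using w[of s] w[of "n - s"] pal[of s] that by simp
    have "z j \<noteq> z i" "z (i + n) = z i" using i j ab(1) by simp_all
    then show ?thesis
      by (rule eventually_periodic_if_right_special[OF n(2) cards(2)])
        (fact 2, fact 3, erule (1) 1, blast)
  qed
  then obtain p d where "d > 0" "\<And>r. r \<ge> p \<Longrightarrow> z (r + d) = z r" by blast
  then have "card (factors z (p + d)) \<le> p + d" by (rule card_factors_eventually_periodic)
  with unbounded[of "p + d"] show False by simp
qed

subsection \<open>Binomial complexity\<close>

lemma binomial_complexity_eq_card_image:
  "binomial_complexity k z n = card ((\<lambda>x. binomial_equiv k `` {x}) ` factors z n)"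
  unfolding binomial_complexity_def quotient_def by (simp add: UNION_singleton_eq_range)

lemma binomial_complexity_le_card_factors:
  fixes z :: "nat \<Rightarrow> 'a::finite"
  shows "binomial_complexity k z n \<le> card (factors z n)"
  unfolding binomial_complexity_eq_card_image by (intro card_image_le finite_factors)

lemma binomial_complexity_eq_card_factors:
  assumes "\<And>x y. x \<in> factors z n \<Longrightarrow> y \<in> factors z n \<Longrightarrow> (x, y) \<in> binomial_equiv k \<Longrightarrow> x = y"
  shows "binomial_complexity k z n = card (factors z n)"
  unfolding binomial_complexity_eq_card_image
proof (rule card_image, rule inj_onI)
  fix x y assume xy: "x \<in> factors z n" "y \<in> factors z n"
    and "binomial_equiv k `` {x} = binomial_equiv k `` {y}"
  moreover have "(y, y) \<in> binomial_equiv k" by (simp add: binomial_equiv_def)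
  ultimately have "(x, y) \<in> binomial_equiv k" by blast
  with xy show "x = y" by (rule assms)
qed

theorem theorem2p11:
  fixes z :: "nat \<Rightarrow> 'a::finite" and k :: nat
  assumes "k \<ge> 2"
    and "\<And>n. binomial_complexity k z n = n + 1"
  shows "sturmian z"
proof -
  have letters: "factors z 1 = (\<lambda>c. [c]) ` range z" by (auto simp: factors_def)
  \<comment> \<open>Length 1 shows that the word has exactly two letters.\<close>
  have "binomial_complexity k z 1 = card (factors z 1)"
  proof (rule binomial_complexity_eq_card_factors)
    fix x y assume "x \<in> factors z 1" "y \<in> factors z 1"
    then obtain c d where xy: "x = [c]" "y = [d]" unfolding letters by blast
    assume "(x, y) \<in> binomial_equiv k"
    then have "\<forall>u. length u \<le> k \<longrightarrow> subword_count [c] u = subword_count [d] u"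
      unfolding binomial_equiv_def xy by simp
    then have "subword_count [c] [c] = subword_count [d] [c]"
      using assms(1) by (metis One_nat_def Suc_1 Suc_leD length_Cons list.size(3))
    then show "x = y" unfolding xy by (simp add: subword_count_rec split: if_splits)
  qed
  then have "card (range z) = 2"
    unfolding letters assms(2) by (simp add: card_image inj_on_def)
  then obtain a b where ab: "a \<noteq> b" "range z \<subseteq> {a, b}" by (metis card_2_iff order_refl)
  have card: "card (factors z n) = n + 1" if bal: "\<And>l. l < n \<Longrightarrow> balanced_at z a l" for n
  proof -
    have "binomial_complexity k z n = card (factors z n)"
    proof (rule binomial_complexity_eq_card_factors)
      fix x y assume "x \<in> factors z n" "y \<in> factors z n" "(x, y) \<in> binomial_equiv k"
      then show "x = y"
        using binomial_equiv_imp_eq[OF ab bal _ assms(1)] unfolding factors_def by blast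
    qed
    then show ?thesis using assms(2) by simp
  qed
  have "balanced_at z a m" for m
  proof (induction m rule: less_induct)
    case (less m)
    show ?case
    proof (rule balanced_if_card_factors[OF ab less])
      \<comment> \<open>The count in length \<open>l\<close> uses balance only below
        \<open>l\<close>, so \<open>l = m\<close> is covered by the induction hypothesis.\<close>
      show "card (factors z l) = l + 1" if "l \<le> m" for l using that less by (intro card) simp
      show "n + 1 \<le> card (factors z n)" for n
        using binomial_complexity_le_card_factors[of k z n] assms(2) by simp
    qed
  qed
  with card show ?thesis unfolding sturmian_def by blast
qed

end
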